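(* Let $B_{\mathcal M}$ be the ideal of meager downward-closed subsets of $[\omega]^\omega$. Then $\mathbf{add}(B_{\mathcal M}) = \mathbf{unif}(B_{\mathcal M}) = \mathfrak b$ and $\mathbf{cov}(B_{\mathcal M}) = \mathbf{cof}(B_{\mathcal M}) = \mathfrak d$.
   Context: $2^\omega$ carries the product topology (two-point discrete factors); meager means first category in this topology. Subsets of $\omega$ are identified with their characteristic functions, and $[\omega]^\omega \subseteq 2^\omega$ is the set of infinite subsets of $\omega$. For $x,y \subseteq \omega$, write $x \le y$ if $x - y$ is finite. A set $A \subseteq [\omega]^\omega$ is downward-closed if whenever $x \in A$, $y \in [\omega]^\omega$ and $y \le x$, then $y \in A$. $\mathcal M([\omega]^\omega)$ is the lattice (under inclusion) of downward-closed subsets of $[\omega]^\omega$, and $B_{\mathcal M}$ is the family of its meager members. For an ideal $I$ in $\mathcal M([\omega]^\omega)$, let $X=\bigcup I$ be the union of all sets in $I$ (for $I=B_{\mathcal M}$, $X$ is the family of all infinite, co-infinite subsets of $\omega$). Then: $\mathbf{add}(I)$ is the smallest cardinality of a subfamily of $I$ whose union is not a member of $I$; $\mathbf{cov}(I)$ is the smallest cardinality of a subfamily of $I$ whose union is $X$; $\mathbf{unif}(I)$ is the smallest cardinality of a subset of $X$ not included in any member of $I$; $\mathbf{cof}(I)$ is the smallest cardinality of a subfamily $C$ of $I$ such that every member of $I$ is a subset of some member of $C$. A function $g:\omega\to\omega$ eventually majorizes $f:\omega\to\omega$ if $f(n)\le g(n)$ for all sufficiently large $n$. $\mathfrak b$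 is the smallest cardinality of a family $F$ of functions $\omega\to\omega$ such that no single function $\omega\to\omega$ eventually majorizes each member of $F$. $\mathfrak d$ is the smallest cardinality of a family $F$ of functions $\omega\to\omega$ such that every function $\omega\to\omega$ is eventually majorized by one from $F$. *)

theory Defs
  imports "HOL-Analysis.Analysis"
begin

unbundle cardinal_syntax

text \<open>Cardinals are cardinal orders up to \<open>=o\<close>, so cardinals of families over different types
  can be compared. The value of \<open>least_card P\<close> is meaningful only if some set satisfies \<open>P\<close>;
  \<open>least_card_attained\<close> and \<open>least_card_least\<close> below characterise it in that case.\<close>

definition least_card :: "('a set \<Rightarrow> bool) \<Rightarrow> 'a rel" where
  "least_card P = |SOME A. P A \<and> (\<forall>B. P B \<longrightarrow> |A| \<le>o |B| )|"

lemma least_card_ex: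
  assumes "P C"
  shows "\<exists>A. P A \<and> (\<forall>B. P B \<longrightarrow> |A| \<le>o |B| )"
proof -
  have "\<exists>r \<in> card_of ` Collect P. \<forall>r' \<in> card_of ` Collect P. r \<le>o r'"
    by (rule exists_minim_Card_order) (use assms card_of_Card_order in auto)
  then show ?thesis by auto
qed

lemma least_card_attained:
  assumes "P C"
  shows "\<exists>A. P A \<and> least_card P = |A|"
  unfolding least_card_def using someI_ex[OF least_card_ex[of P, OF assms]] by blast

lemma least_card_least:
  assumes "P C"
  shows "least_card P \<le>o |C|"
  unfolding least_card_def using someI_ex[OF least_card_ex[of P, OF assms]] assms by blast

definition add_card :: "'a set set \<Rightarrow> 'a set rel" where
  "add_card I = least_card (\<lambda>C. C \<subseteq> I \<and> \<Union>C \<notin> I)"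

definition cov_card :: "'a set set \<Rightarrow> 'a set rel" where
  "cov_card I = least_card (\<lambda>C. C \<subseteq> I \<and> \<Union>C = \<Union>I)"

definition unif_card :: "'a set set \<Rightarrow> 'a rel" where
  "unif_card I = least_card (\<lambda>S. S \<subseteq> \<Union>I \<and> (\<forall>A\<in>I. \<not> S \<subseteq> A))"

definition cof_card :: "'a set set \<Rightarrow> 'a set rel" where
  "cof_card I = least_card (\<lambda>C. C \<subseteq> I \<and> (\<forall>A\<in>I. \<exists>B\<in>C. A \<subseteq> B))"

definition eventually_majorizes :: "(nat \<Rightarrow> nat) \<Rightarrow> (nat \<Rightarrow> nat) \<Rightarrow> bool" where
  "eventually_majorizes g f \<longleftrightarrow> (\<forall>\<^sub>F n in sequentially. f n \<le> g n)"

definition bounding_number :: "(nat \<Rightarrow> nat) rel" where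
  "bounding_number = least_card (\<lambda>F. \<not> (\<exists>g. \<forall>f\<in>F. eventually_majorizes g f))"

definition dominating_number :: "(nat \<Rightarrow> nat) rel" where
  "dominating_number = least_card (\<lambda>F. \<forall>f. \<exists>g\<in>F. eventually_majorizes g f)"

definition nowhere_dense :: "'a::topological_space set \<Rightarrow> bool" where
  "nowhere_dense S \<longleftrightarrow> interior (closure S) = {}"

definition meager :: "'a::topological_space set \<Rightarrow> bool" where
  "meager S \<longleftrightarrow> (\<exists>N. countable N \<and> (\<forall>T\<in>N. nowhere_dense T) \<and> S = \<Union>N)"

text \<open>The type \<open>nat \<Rightarrow> bool\<close> carries the product topology of discrete two-point
  spaces; \<open>char_fun\<close> identifies \<open>nat set\<close> with it.\<close>

definition char_fun :: "nat set \<Rightarrow> (nat \<Rightarrow> bool)" where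
  "char_fun x = (\<lambda>n. n \<in> x)"

definition almost_subset :: "nat set \<Rightarrow> nat set \<Rightarrow> bool" where
  "almost_subset x y \<longleftrightarrow> finite (x - y)"

definition infinite_sets :: "nat set set" where
  "infinite_sets = {x. infinite x}"

definition downward_closed_families :: "nat set set set" where
  "downward_closed_families =
     {A. A \<subseteq> infinite_sets \<and>
         (\<forall>x\<in>A. \<forall>y\<in>infinite_sets. almost_subset y x \<longrightarrow> y \<in> A)}"

definition meager_downward_closed :: "nat set set set" where
  "meager_downward_closed = {A \<in> downward_closed_families. meager (char_fun ` A)}"

end

theory Submission
  imports Defs
begin

text \<open>Call \<open>x\<close> gapped by \<open>f\<close> if for almost all \<open>n\<close> the interval \<open>{n..f n}\<close> is not contained in
  \<open>x\<close>. The infinite sets gapped by \<open>f\<close> form a meager downward-closed family that increases with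
  \<open>f\<close> modulo eventual majorization, and by a Talagrand-style argument every meager
  downward-closed family is contained in one of these. So all four invariants are
  governed by eventual majorization; the bounds from \<open>unif\<close> and \<open>cov\<close> use that
  every \<open>f\<close> is encoded by a single coinfinite set \<open>x\<close> in such a way that a function by which \<open>x\<close>
  is gapped computes a function eventually majorizing \<open>f\<close>.\<close>

section \<open>Category in Cantor space\<close>

lemma open_cylinder: "open {z :: nat \<Rightarrow> bool. \<forall>i<m. z i = s i}"
proof -
  have "{z :: nat \<Rightarrow> bool. \<forall>i<m. z i = s i} = (\<Inter>i\<in>{..<m}. (\<lambda>z. z i) -` {s i})"
    by auto
  also have "open \<dots>"
    by (intro open_INT ballI open_vimage continuous_on_product_coordinates open_discrete) auto
  finally show ?thesis .
qed

text \<open>A basic open box restricts only finitely many coordinates; any bound of these serves as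
  \<open>m\<close>.\<close>

lemma open_contains_cylinder:
  fixes U :: "(nat \<Rightarrow> bool) set"
  assumes "open U" "y \<in> U"
  obtains m where "\<And>z. (\<And>i. i < m \<Longrightarrow> z i = y i) \<Longrightarrow> z \<in> U"
proof -
  obtain X where X: "y \<in> Pi\<^sub>E UNIV X" "finite {i. X i \<noteq> UNIV}" "Pi\<^sub>E UNIV X \<subseteq> U"
    using product_topology_open_contains_basis[of "\<lambda>_. euclidean" UNIV U y] assms
    by (auto simp: open_fun_def)
  obtain m where m: "{i. X i \<noteq> UNIV} \<subseteq> {..<m}"
    using X(2) finite_nat_iff_bounded by blast
  have "z \<in> U" if "\<And>i. i < m \<Longrightarrow> z i = y i" for z
  proof -
    have "z i \<in> X i" for i
      using X(1) m that[of i] by (cases "i < m") (auto simp: PiE_iff)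
    then show ?thesis using X(3) by (auto simp: PiE_iff)
  qed
  then show ?thesis using that by blast
qed

lemma nowhere_dense_subset:
  "nowhere_dense T \<Longrightarrow> S \<subseteq> T \<Longrightarrow> nowhere_dense S"
  unfolding nowhere_dense_def by (metis closure_mono interior_mono subset_empty)

lemma nowhere_dense_empty: "nowhere_dense {}"
  by (simp add: nowhere_dense_def)

lemma nowhere_dense_Un:
  "nowhere_dense S \<Longrightarrow> nowhere_dense T \<Longrightarrow> nowhere_dense (S \<union> T)"
  unfolding nowhere_dense_def by (simp add: interior_closed_Un_empty_interior)

lemma nowhere_dense_UN_atMost:
  fixes T :: "nat \<Rightarrow> 'a::topological_space set"
  assumes "\<And>i. nowhere_dense (T i)"
  shows "nowhere_dense (\<Union>i\<le>n. T i)"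
  by (induction n) (auto simp: atMost_Suc assms intro: nowhere_dense_Un)

lemma meager_subset:
  assumes "meager S" "R \<subseteq> S"
  shows "meager R"
proof -
  obtain N where N: "countable N" "\<forall>T\<in>N. nowhere_dense T" "S = \<Union>N"
    using assms(1) unfolding meager_def by blast
  have "\<forall>T\<in>(\<lambda>T. T \<inter> R) ` N. nowhere_dense T"
    using N(2) nowhere_dense_subset by blast
  moreover have "R = \<Union>((\<lambda>T. T \<inter> R) ` N)"
    using N(3) assms(2) by auto
  ultimately show ?thesis
    unfolding meager_def using N(1) by blast
qed

lemma meager_imp_sequence:
  assumes "meager S"
  shows "\<exists>T :: nat \<Rightarrow> 'a::topological_space set. (\<forall>n. nowhere_dense (T n)) \<and> S = (\<Union>n. T n)"
proof -
  obtain N where N: "countable N" "\<forall>T\<in>N. nowhere_dense T" "S = \<Union>N"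
    using assms unfolding meager_def by blast
  \<comment> \<open>\<open>from_nat_into\<close> enumerates only nonempty sets, so \<open>{}\<close>
    is inserted to cover \<open>N = {}\<close>; the union stays the same.\<close>
  have r: "range (from_nat_into (insert {} N)) = insert {} N"
    using N(1) by (simp add: range_from_nat_into)
  show ?thesis
  proof (intro exI conjI allI)
    show "nowhere_dense (from_nat_into (insert {} N) n)" for n
      using from_nat_into[of "insert {} N" n] N(2) nowhere_dense_empty by auto
    show "S = (\<Union>n. from_nat_into (insert {} N) n)"
      using r N(3) by auto
  qed
qed

text \<open>The open nonempty cylinder of \<open>s\<close> cannot lie in the closure of
  \<open>E\<close>, and a point of it outside the closure has a whole cylinder disjoint from
  \<open>E\<close>.\<close>

lemma nowhere_dense_avoid_cylinder:
  fixes E :: "(nat \<Rightarrow> bool) set"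
  assumes "nowhere_dense E"
  shows "\<exists>m' s'. m \<le> m' \<and> (\<forall>i<m. s' i = s i) \<and> (\<forall>z. (\<forall>i<m'. z i = s' i) \<longrightarrow> z \<notin> E)"
proof -
  let ?C = "{z. \<forall>i<m. z i = s i}"
  have "\<not> ?C \<subseteq> closure E"
    using interior_maximal[OF _ open_cylinder[of m s], of "closure E"] assms
    unfolding nowhere_dense_def by auto
  then obtain y where y: "y \<in> ?C" "y \<in> - closure E" by blast
  obtain k where k: "\<And>z. (\<And>i. i < k \<Longrightarrow> z i = y i) \<Longrightarrow> z \<in> - closure E"
    by (rule open_contains_cylinder[of "- closure E" y]) (use y in auto)
  have "z \<notin> E" if "\<forall>i<max m k. z i = y i" for z
    using k[of z] that closure_subset[of E] by auto
  then show ?thesis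
    using y(1) by (intro exI[of _ "max m k"] exI[of _ y]) auto
qed

text \<open>The finitely many initial segments of length \<open>n\<close> are dealt with one after the other,
  each extending the block.\<close>

lemma nowhere_dense_avoid_block:
  fixes E :: "(nat \<Rightarrow> bool) set"
  assumes "nowhere_dense E"
  shows "\<exists>m t. n \<le> m \<and> (\<forall>z. (\<forall>i\<in>{n..<m}. z i = t i) \<longrightarrow> z \<notin> E)"
proof -
  have "\<exists>m t. n \<le> m \<and> (\<forall>s\<in>S. \<forall>z. (\<forall>i<n. z i = s i) \<longrightarrow> (\<forall>i\<in>{n..<m}. z i = t i) \<longrightarrow> z \<notin> E)"
    if "finite S" for S
    using that
  proof induction
    case empty
    then show ?case by auto
  next
    case (insert s S)
    then obtain m t where mt: "n \<le> m"
      "\<forall>s\<in>S. \<forall>z. (\<forall>i<n. z i = s i) \<longrightarrow> (\<forall>i\<in>{n..<m}. z i = t i) \<longrightarrow> z \<notin> E"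
      by (elim exE conjE)
    obtain m' t' where t': "m \<le> m'" "\<forall>i<m. t' i = (if i < n then s i else t i)"
      "\<forall>z. (\<forall>i<m'. z i = t' i) \<longrightarrow> z \<notin> E"
      using nowhere_dense_avoid_cylinder[OF assms, of m "\<lambda>i. if i < n then s i else t i"]
      by (elim exE conjE)
    have "z \<notin> E" if "r \<in> insert s S" "\<forall>i<n. z i = r i" and z: "\<forall>i\<in>{n..<m'}. z i = t' i" for r z
    proof (cases "r = s")
      case True
      have "z i = t' i" if "i < m'" for i
        using that \<open>\<forall>i<n. z i = r i\<close> z t'(2)[rule_format, of i] mt(1) True by (cases "i < n") auto
      then show ?thesis using t'(3) by blast
    next
      case False
      have "z i = t i" if "i \<in> {n..<m}" for i
        using that z t'(1) t'(2)[rule_format, of i] by auto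
      then show ?thesis using mt(2)[rule_format, of r z] False that by simp
    qed
    then show ?case using mt(1) t'(1) by (intro exI[of _ m'] exI[of _ t']) auto
  qed
  \<comment> \<open>The finitely many functions supported in \<open>{..<n}\<close> represent all
    initial segments of length \<open>n\<close>.\<close>
  from this[of "(\<lambda>a i. i \<in> a) ` Pow {..<n}"] obtain m t where mt: "n \<le> m"
    "\<forall>s\<in>(\<lambda>a i. i \<in> a) ` Pow {..<n}. \<forall>z. (\<forall>i<n. z i = s i) \<longrightarrow>
      (\<forall>i\<in>{n..<m}. z i = t i) \<longrightarrow> z \<notin> E"
    by (elim exE conjE meta_impE) simp
  have "z \<notin> E" if "\<forall>i\<in>{n..<m}. z i = t i" for z
  proof -
    have "(\<lambda>i. i \<in> {i. i < n \<and> z i}) \<in> (\<lambda>a i. i \<in> a) ` Pow {..<n}"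
      by (rule imageI) auto
    from mt(2)[rule_format, OF this, of z] show ?thesis using that by simp
  qed
  then show ?thesis using mt(1) by blast
qed

section \<open>Families of gapped sets\<close>

definition gapped :: "(nat \<Rightarrow> nat) \<Rightarrow> nat set set" where
  "gapped f = {x. infinite x \<and> (\<forall>\<^sub>F n in sequentially. \<exists>k\<in>{n..f n}. k \<notin> x)}"

lemma gapped_mono:
  assumes "eventually_majorizes g f"
  shows "gapped f \<subseteq> gapped g"
proof
  fix x assume x: "x \<in> gapped f"
  have "\<forall>\<^sub>F n in sequentially. \<exists>k\<in>{n..g n}. k \<notin> x"
    using assms[unfolded eventually_majorizes_def] x[unfolded gapped_def, simplified, THEN conjunct2]
    by eventually_elim force
  then show "x \<in> gapped g" using x by (simp add: gapped_def)
qed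

lemma gapped_downward_closed: "gapped f \<in> downward_closed_families"
proof -
  have "y \<in> gapped f" if x: "x \<in> gapped f" and y: "infinite y" "finite (y - x)" for x y
  proof -
    obtain b where b: "y - x \<subseteq> {..<b}"
      using y(2) finite_nat_iff_bounded by blast
    have "\<forall>\<^sub>F n in sequentially. \<exists>k\<in>{n..f n}. k \<notin> y"
      using eventually_ge_at_top[of b] x[unfolded gapped_def, simplified, THEN conjunct2]
    proof eventually_elim
      case (elim n)
      then obtain k where k: "k \<in> {n..f n}" "k \<notin> x" by blast
      then have "k \<notin> y" using b elim(1) by fastforce
      then show ?case using k by blast
    qed
    then show ?thesis using y(1) by (simp add: gapped_def)
  qed
  then show ?thesis
    by (auto simp: downward_closed_families_def infinite_sets_def almost_subset_def gapped_def)
qed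

text \<open>Each gap condition concerns finitely many coordinates, so the set is closed; no cylinder
  lies in it, since a finite pattern can be continued by \<open>True\<close> forever.\<close>

lemma nowhere_dense_gaps_from:
  "nowhere_dense {z :: nat \<Rightarrow> bool. \<forall>n\<ge>N. \<exists>k\<in>{n..f n}. \<not> z k}" (is "nowhere_dense ?E")
proof -
  have "?E = (\<Inter>n\<in>{N..}. \<Union>k\<in>{n..f n}. (\<lambda>z. z k) -` {False})"
    by auto
  moreover have "closed \<dots>"
    by (intro closed_INT ballI closed_UN finite_atLeastAtMost closed_vimage
        continuous_on_product_coordinates closed_singleton)
  ultimately have "closed ?E" by simp
  moreover have "interior ?E = {}"
  proof (rule ccontr)
    assume "interior ?E \<noteq> {}"
    then obtain y where y: "y \<in> interior ?E" by blast
    obtain m where m: "\<And>z. (\<And>i. i < m \<Longrightarrow> z i = y i) \<Longrightarrow> z \<in> interior ?E"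
      using open_contains_cylinder[OF open_interior y] by blast
    have "(\<lambda>i. i < m \<longrightarrow> y i) \<in> ?E"
      using m[of "\<lambda>i. i < m \<longrightarrow> y i"] interior_subset[of ?E] by blast
    then show False by (auto dest!: spec[of _ "max N m"])
  qed
  ultimately show ?thesis by (simp add: nowhere_dense_def)
qed

lemma gapped_meager: "meager (char_fun ` gapped f)"
proof (rule meager_subset)
  let ?E = "\<lambda>N. {z :: nat \<Rightarrow> bool. \<forall>n\<ge>N. \<exists>k\<in>{n..f n}. \<not> z k}"
  show "meager (\<Union>N. ?E N)"
    unfolding meager_def
    using nowhere_dense_gaps_from[of _ f] by (intro exI[of _ "range ?E"]) blast
  show "char_fun ` gapped f \<subseteq> (\<Union>N. ?E N)"
    by (auto simp: gapped_def char_fun_def eventually_sequentially)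
qed

lemma gapped_in_meager_downward_closed: "gapped f \<in> meager_downward_closed"
  by (simp add: meager_downward_closed_def gapped_downward_closed gapped_meager)

lemma gapped_subset_Union: "gapped f \<subseteq> \<Union>meager_downward_closed"
  using gapped_in_meager_downward_closed by blast

text \<open>If \<open>x\<close> contains infinitely many of the blocks, then inside \<open>x\<close> one can copy
  infinitely many of the patterns that avoid the nowhere dense sets.\<close>

lemma meager_downward_closed_subset_gapped:
  assumes "A \<in> meager_downward_closed"
  shows "\<exists>f. A \<subseteq> gapped f"
proof -
  have A: "A \<in> downward_closed_families" "meager (char_fun ` A)"
    using assms by (auto simp: meager_downward_closed_def)
  obtain T :: "nat \<Rightarrow> (nat \<Rightarrow> bool) set"
    where T: "\<And>n. nowhere_dense (T n)" "char_fun ` A = (\<Union>n. T n)"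
    using meager_imp_sequence[OF A(2)] by blast
  \<comment> \<open>The block at \<open>n\<close> avoids \<open>T 0\<close>, ..., \<open>T n\<close>
    together, so a fixed \<open>T j\<close> is avoided by every block starting at or beyond
    \<open>j\<close>.\<close>
  have "\<forall>n. \<exists>m t. n \<le> m \<and> (\<forall>z. (\<forall>i\<in>{n..<m}. z i = t i) \<longrightarrow> z \<notin> (\<Union>i\<le>n. T i))"
    using nowhere_dense_avoid_block[OF nowhere_dense_UN_atMost[of T, OF T(1)]] by (intro allI)
  from this[THEN choice] obtain M where
    "\<forall>n. \<exists>t. n \<le> M n \<and> (\<forall>z. (\<forall>i\<in>{n..<M n}. z i = t i) \<longrightarrow> z \<notin> (\<Union>i\<le>n. T i))" ..
  from this[THEN choice] obtain t where Mt:
    "\<forall>n. n \<le> M n \<and> (\<forall>z. (\<forall>i\<in>{n..<M n}. z i = t n i) \<longrightarrow> z \<notin> (\<Union>i\<le>n. T i))" ..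
  have M: "n \<le> M n" for n
    using Mt by simp
  have avoid: "z \<notin> (\<Union>i\<le>n. T i)" if "\<forall>i\<in>{n..<M n}. z i = t n i" for n z
    using Mt[rule_format, of n, THEN conjunct2, rule_format, of z] that by simp
  \<comment> \<open>\<open>{n..f n}\<close> contains the block starting at \<open>Suc n\<close> and
    also \<open>n\<close> itself, which can be put into a set without disturbing the pattern on that
    block.\<close>
  define f where "f n = M (Suc n)" for n
  have f: "n < f n" for n
    using M[of "Suc n"] by (simp add: f_def)
  have "x \<in> gapped f" if "x \<in> A" for x
  proof (rule ccontr)
    assume "x \<notin> gapped f"
    moreover have "infinite x"
      using A(1) that by (auto simp: downward_closed_families_def infinite_sets_def)
    ultimately have many: "\<exists>n\<ge>N. {n..f n} \<subseteq> x" for N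
      by (force simp: gapped_def eventually_sequentially)
    \<comment> \<open>Disjoint intervals let a pattern be copied into each one
      independently.\<close>
    have "\<exists>p. \<forall>k. {p k..f (p k)} \<subseteq> x \<and> f (p k) < p (Suc k)"
      by (rule dependent_nat_choice) (use many Suc_le_lessD in blast)+
    then obtain p where p: "\<And>k. {p k..f (p k)} \<subseteq> x" "\<And>k. f (p k) < p (Suc k)"
      by blast
    have "strict_mono p"
      using p(2) f by (meson less_trans strict_mono_Suc_iff)
    have later: "f (p k) < p l" if "k < l" for k l
      using p(2)[of k] strict_mono_leD[OF \<open>strict_mono p\<close>, of "Suc k" l] that by linarith
    \<comment> \<open>The points \<open>p k\<close> make \<open>y\<close> infinite, so that downward
      closure puts it into \<open>A\<close>.\<close>
    define y where "y = {i. \<exists>k. i \<in> {p k..f (p k)} \<and> (i = p k \<or> t (Suc (p k)) i)}"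
    have "range p \<subseteq> y"
      using f by (auto simp: y_def less_imp_le)
    then have "infinite y"
      using \<open>strict_mono p\<close> by (meson finite_subset range_inj_infinite strict_mono_imp_inj_on)
    moreover have "y \<subseteq> x"
      using p(1) unfolding y_def by blast
    then have "finite (y - x)"
      by (metis Diff_eq_empty_iff finite.emptyI)
    ultimately have "y \<in> A"
      using A(1) that
      by (auto simp: downward_closed_families_def infinite_sets_def almost_subset_def)
    then obtain j where j: "char_fun y \<in> T j" using T(2) by blast
    have "char_fun y i = t (Suc (p j)) i" if i: "i \<in> {Suc (p j)..<M (Suc (p j))}" for i
    proof -
      have ij: "i \<in> {p j..f (p j)}" "i \<noteq> p j"
        using i by (auto simp: f_def)
      have own: "k = j" if "i \<in> {p k..f (p k)}" for k
        using later[of k j] later[of j k] that ij by (cases k j rule: linorder_cases) auto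
      have "i \<in> y \<longleftrightarrow> t (Suc (p j)) i"
      proof
        assume "i \<in> y"
        then obtain k where k: "i \<in> {p k..f (p k)}" "i = p k \<or> t (Suc (p k)) i"
          unfolding y_def by blast
        then show "t (Suc (p j)) i"
          using ij(2) own[OF k(1)] by simp
      next
        assume "t (Suc (p j)) i"
        then show "i \<in> y"
          unfolding y_def using ij(1) by blast
      qed
      then show ?thesis by (simp add: char_fun_def)
    qed
    then have "char_fun y \<notin> (\<Union>i\<le>Suc (p j). T i)"
      using avoid by blast
    \<comment> \<open>As \<open>j \<le> p j\<close>, the set \<open>T j\<close> is among those
      avoided by the block at \<open>Suc (p j)\<close>.\<close>
    then show False
      using j strict_mono_imp_increasing[OF \<open>strict_mono p\<close>, of j] by (auto simp: le_SucI)
  qed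
  then show ?thesis by blast
qed

section \<open>Coding functions by sets\<close>

text \<open>Serves as a monotone majorant of \<open>g\<close>: a bound on the argument then bounds
  the value.\<close>

definition running_sum :: "(nat \<Rightarrow> nat) \<Rightarrow> nat \<Rightarrow> nat" where
  "running_sum g n = (\<Sum>i\<le>n. g i)"

lemma le_running_sum: "i \<le> n \<Longrightarrow> g i \<le> running_sum g n"
  unfolding running_sum_def by (rule member_le_sum) auto

text \<open>The gap after a sparse point \<open>a\<close> exceeds \<open>f i\<close> for all
  \<open>i \<le> a\<close>, so any later sparse point bounds \<open>f\<close> up to
  \<open>a\<close>.\<close>

primrec sparse_points :: "(nat \<Rightarrow> nat) \<Rightarrow> nat \<Rightarrow> nat" where
  "sparse_points f 0 = 0"
| "sparse_points f (Suc k) = sparse_points f k + 2 + running_sum f (sparse_points f k)"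

lemma strict_mono_sparse_points: "strict_mono (sparse_points f)"
  by (simp add: strict_mono_Suc_iff)

text \<open>The step \<open>+ 2\<close> in the definition of \<^const>\<open>sparse_points\<close> makes this set infinite.\<close>

definition sparse_complement :: "(nat \<Rightarrow> nat) \<Rightarrow> nat set" where
  "sparse_complement f = - range (sparse_points f)"

text \<open>The successor of a sparse point is never sparse, which gives infinitely many elements;
  as \<open>n \<le> sparse_points f n\<close>, the enumeration itself bounds the gaps.\<close>

lemma sparse_complement_gapped: "\<exists>g. sparse_complement f \<in> gapped g"
proof -
  have "Suc (sparse_points f k) \<noteq> sparse_points f l" for k l
  proof (cases "l \<le> k")
    case True
    then show ?thesis
      using strict_mono_leD[OF strict_mono_sparse_points, of l k f] by linarith
  next
    case False
    then show ?thesis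
      using strict_mono_leD[OF strict_mono_sparse_points, of "Suc k" l f] by simp
  qed
  then have "range (Suc \<circ> sparse_points f) \<subseteq> sparse_complement f"
    by (auto simp: sparse_complement_def)
  moreover have "inj (Suc \<circ> sparse_points f)"
    by (simp add: inj_compose strict_mono_imp_inj_on strict_mono_sparse_points)
  ultimately have "infinite (sparse_complement f)"
    by (meson finite_subset range_inj_infinite)
  moreover have "\<exists>k\<in>{n..sparse_points f n}. k \<notin> sparse_complement f" for n
    using strict_mono_imp_increasing[OF strict_mono_sparse_points, of n f]
    by (auto simp: sparse_complement_def intro!: bexI[of _ "sparse_points f n"])
  ultimately have "sparse_complement f \<in> gapped (sparse_points f)"
    by (simp add: gapped_def)
  then show ?thesis by blast
qed

text \<open>If \<open>g\<close> bounds the gaps, the inner sum bounds a sparse point at or above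
  \<open>n\<close>, and the outer sum a later one.\<close>

definition decode :: "(nat \<Rightarrow> nat) \<Rightarrow> nat \<Rightarrow> nat" where
  "decode g n = running_sum g (Suc (running_sum g n))"

text \<open>Two consecutive sparse points above \<open>n\<close> can be found using \<open>g\<close>, and the second exceeds \<open>f n\<close>.\<close>

lemma decode_majorizes:
  assumes "sparse_complement f \<in> gapped g"
  shows "eventually_majorizes (decode g) f"
proof -
  obtain N where N: "\<And>n. n \<ge> N \<Longrightarrow> \<exists>k\<in>{n..g n}. k \<notin> sparse_complement f"
    using assms unfolding gapped_def eventually_sequentially by blast
  have "f n \<le> decode g n" if n: "n \<ge> N" for n
  proof -
    obtain k where k: "n \<le> sparse_points f k" "sparse_points f k \<le> g n"
      using N[OF n] by (auto simp: sparse_complement_def)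
    obtain l where l: "Suc (sparse_points f k) \<le> sparse_points f l"
      "sparse_points f l \<le> g (Suc (sparse_points f k))"
      using N[of "Suc (sparse_points f k)"] n k(1) by (auto simp: sparse_complement_def)
    have "k < l"
      using l(1) strict_mono_less[OF strict_mono_sparse_points] Suc_le_lessD by blast
    have "f n \<le> running_sum f (sparse_points f k)"
      by (rule le_running_sum[OF k(1)])
    also have "\<dots> \<le> sparse_points f (Suc k)"
      by simp
    also have "\<dots> \<le> sparse_points f l"
      using \<open>k < l\<close> by (intro strict_mono_leD[OF strict_mono_sparse_points]) simp
    also have "\<dots> \<le> g (Suc (sparse_points f k))"
      by (rule l(2))
    also have "\<dots> \<le> decode g n"
      unfolding decode_def using k(2) le_running_sum[of n n g] by (intro le_running_sum) simp
    finally show ?thesis .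
  qed
  then show ?thesis
    unfolding eventually_majorizes_def eventually_sequentially by blast
qed

section \<open>The cardinal invariants\<close>

text \<open>A minimal witness for \<open>Q\<close> is carried to a witness for \<open>P\<close> that
  is no larger. \<open>Q C\<close> is assumed because \<open>least_card\<close> is meaningful only
  for satisfiable predicates.\<close>

lemma least_card_mono_image:
  assumes "Q C" and "\<And>C. Q C \<Longrightarrow> P (\<phi> ` C)"
  shows "least_card P \<le>o least_card Q"
proof -
  obtain A where A: "Q A" "least_card Q = |A|"
    using least_card_attained[of Q, OF assms(1)] by blast
  show ?thesis
    unfolding A(2)
    using least_card_least[of P, OF assms(2)[OF A(1)]] card_of_image by (rule ordLeq_transitive)
qed

text \<open>Downward closure survives arbitrary unions but meagerness does not; the common bound
  \<open>gapped g\<close> supplies it.\<close>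

lemma Union_in_meager_downward_closed:
  assumes "C \<subseteq> meager_downward_closed" "\<Union>C \<subseteq> gapped g"
  shows "\<Union>C \<in> meager_downward_closed"
proof -
  have "meager (char_fun ` \<Union>C)"
    using meager_subset[OF gapped_meager image_mono[OF assms(2)]] .
  moreover have "\<Union>C \<in> downward_closed_families"
    using assms(1) unfolding meager_downward_closed_def downward_closed_families_def by blast
  ultimately show ?thesis by (simp add: meager_downward_closed_def)
qed

lemma unbounded_UNIV: "\<not> (\<exists>g. \<forall>f\<in>UNIV. eventually_majorizes g f)"
proof
  assume "\<exists>g. \<forall>f\<in>UNIV. eventually_majorizes g f"
  then obtain g where "eventually_majorizes g (\<lambda>n. Suc (g n))" by blast
  then show False by (simp add: eventually_majorizes_def)
qed

lemma dominating_UNIV: "\<forall>f. \<exists>g\<in>UNIV. eventually_majorizes g f"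
proof
  show "\<exists>g\<in>UNIV. eventually_majorizes g f" for f
    by (rule bexI[of _ f]) (simp_all add: eventually_majorizes_def)
qed

theorem theorem3:
  shows "add_card meager_downward_closed =o unif_card meager_downward_closed \<and>
         unif_card meager_downward_closed =o bounding_number \<and>
         cov_card meager_downward_closed =o cof_card meager_downward_closed \<and>
         cof_card meager_downward_closed =o dominating_number"
proof -
  let ?I = meager_downward_closed
  let ?add = "\<lambda>C. C \<subseteq> ?I \<and> \<Union>C \<notin> ?I"
  let ?cov = "\<lambda>C. C \<subseteq> ?I \<and> \<Union>C = \<Union>?I"
  let ?unif = "\<lambda>S. S \<subseteq> \<Union>?I \<and> (\<forall>A\<in>?I. \<not> S \<subseteq> A)"
  let ?cof = "\<lambda>C. C \<subseteq> ?I \<and> (\<forall>A\<in>?I. \<exists>B\<in>C. A \<subseteq> B)"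
  let ?b = "\<lambda>F. \<not> (\<exists>g. \<forall>f\<in>F. eventually_majorizes g f)"
  let ?d = "\<lambda>F. \<forall>f. \<exists>g\<in>F. eventually_majorizes g f"
  obtain \<phi> where \<phi>: "\<And>A. A \<in> ?I \<Longrightarrow> A \<subseteq> gapped (\<phi> A)"
    using meager_downward_closed_subset_gapped by metis
  then have "\<forall>x\<in>\<Union>?I. \<exists>f. x \<in> gapped f"
    by blast
  from bchoice[OF this] obtain \<psi> where \<psi>: "\<And>x. x \<in> \<Union>?I \<Longrightarrow> x \<in> gapped (\<psi> x)"
    by blast
  have sparse: "sparse_complement f \<in> \<Union>?I" for f
    using sparse_complement_gapped gapped_subset_Union by blast

  \<comment> \<open>If one \<open>A\<close> contained all the codes,
    \<open>decode (\<phi> A)\<close> would eventually majorize every member of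
    \<open>F\<close>.\<close>
  have b_unif: "?unif (sparse_complement ` F)" if "?b F" for F
  proof -
    have False if "A \<in> ?I" "sparse_complement ` F \<subseteq> A" for A
    proof -
      have "\<forall>f\<in>F. sparse_complement f \<in> gapped (\<phi> A)"
        using \<phi> that by blast
      then show False
        using decode_majorizes \<open>?b F\<close> by blast
    qed
    moreover have "sparse_complement ` F \<subseteq> \<Union>?I"
      using sparse by (rule image_subsetI)
    ultimately show ?thesis by (intro conjI ballI notI)
  qed
  have unif_add: "?add ((\<lambda>x. gapped (\<psi> x)) ` S)" if "?unif S" for S
  proof -
    have "S \<subseteq> \<Union>((\<lambda>x. gapped (\<psi> x)) ` S)"
      using \<psi> that by blast
    then have "\<Union>((\<lambda>x. gapped (\<psi> x)) ` S) \<notin> ?I"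
      using that by metis
    moreover have "(\<lambda>x. gapped (\<psi> x)) ` S \<subseteq> ?I"
      using gapped_in_meager_downward_closed by (rule image_subsetI)
    ultimately show ?thesis by (rule conjI[rotated])
  qed
  \<comment> \<open>A common majorant \<open>g\<close> of the chosen functions would put the union
    inside \<open>gapped g\<close>, hence into the ideal.\<close>
  have add_b: "?b (\<phi> ` C)" if "?add C" for C
  proof
    assume "\<exists>g. \<forall>f\<in>\<phi> ` C. eventually_majorizes g f"
    then obtain g where "\<And>A. A \<in> C \<Longrightarrow> eventually_majorizes g (\<phi> A)" by blast
    then have "\<Union>C \<subseteq> gapped g"
      using gapped_mono \<phi> that by (meson Sup_least subset_iff)
    then show False
      using Union_in_meager_downward_closed[of C g] that by simp
  qed
  have d_cof: "?cof (gapped ` F)" if "?d F" for F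
  proof (intro conjI ballI)
    show "gapped ` F \<subseteq> ?I"
      using gapped_in_meager_downward_closed by (rule image_subsetI)
    fix A assume "A \<in> ?I"
    obtain g where g: "g \<in> F" "eventually_majorizes g (\<phi> A)"
      using \<open>?d F\<close> by blast
    show "\<exists>B\<in>gapped ` F. A \<subseteq> B"
      using subset_trans[OF \<phi>[OF \<open>A \<in> ?I\<close>] gapped_mono[OF g(2)]]
      by (rule bexI[OF _ imageI[OF g(1)]])
  qed
  \<comment> \<open>A cofinal family already covers; \<open>id\<close> only gives it the image form
    used by \<open>least_card_mono_image\<close>.\<close>
  have cof_cov: "?cov (id ` C)" if "?cof C" for C
  proof
    show "id ` C \<subseteq> ?I"
      using that by simp
    show "\<Union>(id ` C) = \<Union>?I"
    proof (rule subset_antisym)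
      show "\<Union>(id ` C) \<subseteq> \<Union>?I"
        using that by (simp add: Union_mono)
      show "\<Union>?I \<subseteq> \<Union>(id ` C)"
        using that by (intro Union_subsetI) (simp add: Bex_def)
    qed
  qed
  \<comment> \<open>The member of the cover that contains the code of \<open>f\<close> decodes to a
    majorant of \<open>f\<close>.\<close>
  have cov_d: "?d ((\<lambda>A. decode (\<phi> A)) ` C)" if "?cov C" for C
  proof
    fix f
    obtain A where A: "A \<in> C" "sparse_complement f \<in> A"
      using sparse[of f] \<open>?cov C\<close> by blast
    then have "sparse_complement f \<in> gapped (\<phi> A)"
      using \<phi>[of A] that by blast
    from decode_majorizes[OF this]
    show "\<exists>g\<in>(\<lambda>A. decode (\<phi> A)) ` C. eventually_majorizes g f"
      using A(1) by auto
  qed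

  note defs = add_card_def unif_card_def cov_card_def cof_card_def
    bounding_number_def dominating_number_def
  \<comment> \<open>Satisfiability of all six predicates is passed on from \<open>UNIV\<close> along
    the same maps.\<close>
  note unif_ex = b_unif[OF unbounded_UNIV]
  note add_ex = unif_add[OF unif_ex]
  note cof_ex = d_cof[OF dominating_UNIV]
  note cov_ex = cof_cov[OF cof_ex]
  \<comment> \<open>Two cycles of inequalities follow, each closed by its third one, so all members
    of a cycle are equal.\<close>
  have "unif_card ?I \<le>o bounding_number"
    unfolding defs by (rule least_card_mono_image[of ?b _ ?unif sparse_complement]) (fact unbounded_UNIV, fact b_unif)
  moreover have "add_card ?I \<le>o unif_card ?I"
    unfolding defs by (rule least_card_mono_image[of ?unif _ ?add "\<lambda>x. gapped (\<psi> x)"]) (fact unif_ex, fact unif_add)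
  moreover have "bounding_number \<le>o add_card ?I"
    unfolding defs by (rule least_card_mono_image[of ?add _ ?b \<phi>]) (fact add_ex, fact add_b)
  moreover have "cof_card ?I \<le>o dominating_number"
    unfolding defs by (rule least_card_mono_image[of ?d _ ?cof gapped]) (fact dominating_UNIV, fact d_cof)
  moreover have "cov_card ?I \<le>o cof_card ?I"
    unfolding defs by (rule least_card_mono_image[of ?cof _ ?cov id]) (fact cof_ex, fact cof_cov)
  moreover have "dominating_number \<le>o cov_card ?I"
    unfolding defs by (rule least_card_mono_image[of ?cov _ ?d "\<lambda>A. decode (\<phi> A)"]) (fact cov_ex, fact cov_d)
  ultimately show ?thesis
    by (meson ordIso_iff_ordLeq ordLeq_transitive)
qed

end
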